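(* Let $n,p,r$ be nonnegative integers with $2\leqslant r<n-p$. Then $$|\mathcal{P}_{n,p}^{r-1}[n-p\prec 1]|=(p+1)\,|\mathcal{P}_{n+1,p+1}^{r}[n-p\prec 1]|.$$
   Context: A plane tree is a rooted tree in which the children of every vertex are linearly ordered. The degree of a vertex in a rooted tree is its number of children, and a leaf is a vertex of degree zero. A plane tree (or a forest of plane trees) is non-leaf vertex labeled if its leaves are not labeled while all other vertices are labeled. $\mathcal{P}_{n,p}^{r}$ denotes the set of forests of $r$ non-leaf vertex labeled plane trees having $n$ vertices in total, exactly $p$ of which are leaves, the $n-p$ non-leaf vertices being labeled bijectively by $\{1,\ldots,n-p\}$, and with the roots of the $r$ trees being the vertices labeled $1,\ldots,r$ (so in particular every root is a non-leaf). Forests are counted up to isomorphism preserving roots, the orders of children, and labels. A vertex $y$ is a descendant of $x$, written $y\prec x$, if $x$ lies on the path from the root of the tree containing $y$ to $y$. For integers $N,q,s,m$, $\mathcal{P}_{N,q}^{s}[m\prec 1]$ denotes the subset of those forests in $\mathcal{P}_{N,q}^{s}$ in which the vertex labeled $m$ lies in the tree rooted at $1$. *)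

theory Defs
  imports Main "HOL-Library.Multiset"
begin

text \<open>
  A plane tree with optional vertex labels; \<open>None\<close> means unlabeled. Two labeled plane trees are
  isomorphic (preserving root, order of children and labels) iff the corresponding values of this
  type are equal, so its values are exactly the isomorphism classes.
\<close>
datatype plane_tree = Node (label: "nat option") (children: "plane_tree list")

definition degree :: "plane_tree \<Rightarrow> nat" where
  "degree v = length (children v)"

text \<open>
  The vertices of a tree, each represented by the subtree hanging at it. This is a multiset because
  distinct vertices (for instance, all leaves) can carry equal subtrees.
\<close>
primrec vertices :: "plane_tree \<Rightarrow> plane_tree multiset" where
  "vertices (Node l ts) = add_mset (Node l ts) (sum_list (map vertices ts))"

text \<open>A forest up to isomorphism is a finite multiset of isomorphism classes of trees.\<close>
type_synonym forest = "plane_tree multiset"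

definition forest_vertices :: "forest \<Rightarrow> plane_tree multiset" where
  "forest_vertices F = (\<Sum>t\<in>#F. vertices t)"

definition leaves :: "forest \<Rightarrow> plane_tree multiset" where
  "leaves F = {#v \<in># forest_vertices F. degree v = 0#}"

definition non_leaves :: "forest \<Rightarrow> plane_tree multiset" where
  "non_leaves F = {#v \<in># forest_vertices F. degree v \<noteq> 0#}"

text \<open>
  \<open>labeled_forests n p r\<close> is $\mathcal{P}_{n,p}^{r}$. Equality of the multiset of labels with the
  multiset in which each of \<open>1, \<dots>, k\<close> occurs once says that the labeling is a bijection onto
  \<open>{1..k}\<close>.
\<close>
definition labeled_forests :: "nat \<Rightarrow> nat \<Rightarrow> nat \<Rightarrow> forest set" where
  "labeled_forests n p r =
    {F. size F = r \<and>
        size (forest_vertices F) = n \<and>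
        size (leaves F) = p \<and>
        (\<forall>v \<in># leaves F. label v = None) \<and>
        image_mset label (non_leaves F) = mset_set (Some ` {1..n - p}) \<and>
        image_mset label F = mset_set (Some ` {1..r})}"

text \<open>
  \<open>labeled_forests_below_1 n p r m\<close> is $\mathcal{P}_{n,p}^{r}[m \prec 1]$.
\<close>
definition labeled_forests_below_1 :: "nat \<Rightarrow> nat \<Rightarrow> nat \<Rightarrow> nat \<Rightarrow> forest set" where
  "labeled_forests_below_1 n p r m =
    {F \<in> labeled_forests n p r.
       \<exists>t \<in># F. label t = Some 1 \<and> (\<exists>v \<in># vertices t. label v = Some m)}"

end

theory Submission
  imports Defs "HOL-Combinatorics.Transposition"
begin

text \<open>
  Let \<open>k = n - p\<close>. Cutting the subtree at the vertex \<open>r\<close> off a forest with roots \<open>1, \<dots>, r - 1\<close>, and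
  leaving a marked leaf in its place, is a bijection onto the forests with roots \<open>1, \<dots>, r\<close> and one
  marked leaf outside the tree of \<open>r\<close>. The vertex \<open>k\<close> was below \<open>1\<close> iff now either \<open>k\<close> is in the tree
  of \<open>1\<close>, or \<open>k\<close> is in the tree of \<open>r\<close> and the marked leaf is in the tree of \<open>1\<close>. In the second
  case exchanging the labels \<open>1\<close> and \<open>r\<close> gives the forests with \<open>k\<close> in the tree of \<open>1\<close> and the
  marked leaf in the tree of \<open>r\<close>. Both cases together give every forest with \<open>k\<close> below \<open>1\<close> and an
  arbitrary one of its \<open>p + 1\<close> leaves marked.

  A marked leaf is encoded as a leaf with the otherwise unused label \<open>Some 0\<close>.
\<close>

section \<open>Label multisets, and forests as lists of trees\<close>

definition labels :: "plane_tree \<Rightarrow> nat option multiset" where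
  "labels t = image_mset label (vertices t)"

definition forest_labels :: "plane_tree list \<Rightarrow> nat option multiset" where
  "forest_labels ts = (\<Sum>t\<leftarrow>ts. labels t)"

definition proper :: "plane_tree \<Rightarrow> bool" where
  "proper t \<longleftrightarrow> (\<forall>v\<in>#vertices t. degree v = 0 \<longleftrightarrow> label v = None \<or> label v = Some 0)"

text \<open>The multiset \<open>X\<close> fixes the numbers of plain leaves and of marks and the
  labels in use. Increasing root labels make \<open>hd ts\<close> the tree of \<open>1\<close> and
  \<open>last ts\<close> the tree of \<open>r\<close>.\<close>

definition ordered_forests :: "nat option multiset \<Rightarrow> nat \<Rightarrow> plane_tree list set" where
  "ordered_forests X r =
    {ts. map label ts = map Some [1..<Suc r] \<and> (\<forall>t\<in>set ts. proper t) \<and> forest_labels ts = X}"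

lemma forest_labels_simps [simp]:
  "forest_labels [] = {#}"
  "forest_labels (t # ts) = labels t + forest_labels ts"
  "forest_labels (ts @ us) = forest_labels ts + forest_labels us"
  by (auto simp: forest_labels_def)

lemma labels_Node [simp]: "labels (Node l ts) = add_mset l (forest_labels ts)"
proof -
  have "image_mset label (sum_list (map vertices ts)) = forest_labels ts"
    by (induction ts) (auto simp: labels_def)
  then show ?thesis by (simp add: labels_def)
qed

lemma in_sum_list_mset: "x \<in># sum_list (map f ts) \<longleftrightarrow> (\<exists>t\<in>set ts. x \<in># f t)"
  by (induction ts) auto

lemma in_forest_labels: "l \<in># forest_labels ts \<longleftrightarrow> (\<exists>t\<in>set ts. l \<in># labels t)"
  by (simp add: forest_labels_def in_sum_list_mset)

lemma proper_Node [simp]: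
  "proper (Node l ts) \<longleftrightarrow> (ts = [] \<longleftrightarrow> l = None \<or> l = Some 0) \<and> (\<forall>t\<in>set ts. proper t)"
  by (auto simp: proper_def degree_def in_sum_list_mset)

lemma label_in_labels: "label t \<in># labels t"
  by (cases t) auto

lemma ordered_forests_length: "ts \<in> ordered_forests X r \<Longrightarrow> length ts = r"
  unfolding ordered_forests_def by (metis (mono_tags, lifting) diff_Suc_1 length_map length_upt mem_Collect_eq)


section \<open>Ordering the trees of a forest\<close>

lemma image_mset_eq_mset_ex:
  "image_mset f M = mset xs \<Longrightarrow> \<exists>ys. mset ys = M \<and> map f ys = xs"
proof (induction xs arbitrary: M)
  case (Cons x xs)
  then obtain a N where "M = add_mset a N" "f a = x" "image_mset f N = mset xs"
    using msed_map_invR[of f M x "mset xs"] by auto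
  with Cons.IH[of N] show ?case by (metis list.simps(9) mset.simps(2))
qed auto

text \<open>Since the values in \<open>xs\<close> are distinct, \<open>f\<close> is injective on the
  members of such a list, so the multiset leaves only one possible order.\<close>

lemma bij_betw_mset_sorted:
  assumes "distinct xs"
  shows "bij_betw mset {ts. map f ts = xs \<and> P (mset ts)} {F. image_mset f F = mset xs \<and> P F}"
  unfolding bij_betw_def
proof (intro conjI inj_onI set_eqI iffI)
  fix ts us
  assume "ts \<in> {ts. map f ts = xs \<and> P (mset ts)}" "us \<in> {ts. map f ts = xs \<and> P (mset ts)}"
    and eq: "mset ts = mset us"
  then have m: "map f ts = xs" "map f us = xs" by auto
  have "set ts = set us" using eq by (rule mset_eq_setD)
  moreover have "inj_on f (set ts)" using assms m by (metis distinct_map)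
  ultimately show "ts = us" using m by (intro map_inj_on[of f ts us]) auto
next
  fix F assume "F \<in> {F. image_mset f F = mset xs \<and> P F}"
  then show "F \<in> mset ` {ts. map f ts = xs \<and> P (mset ts)}"
    using image_mset_eq_mset_ex[of f F xs] by auto
qed auto

lemma forest_vertices_mset: "forest_vertices (mset ts) = sum_list (map vertices ts)"
  unfolding forest_vertices_def by (induction ts) auto

lemma forest_labels_eq: "forest_labels ts = image_mset label (forest_vertices (mset ts))"
  unfolding forest_vertices_mset by (induction ts) (auto simp: labels_def)

lemma proper_forest_iff:
  "(\<forall>t\<in>set ts. proper t) \<longleftrightarrow>
    (\<forall>v\<in>#forest_vertices (mset ts). degree v = 0 \<longleftrightarrow> label v = None \<or> label v = Some 0)"
  unfolding forest_vertices_mset proper_def by (auto simp: in_sum_list_mset)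

text \<open>Trades the separate conditions on leaves and non-leaves for one label multiset. Going
  back, \<open>Some 0\<close> does not occur in that multiset, so among the vertices the leaves are
  exactly those labeled \<open>None\<close>.\<close>

lemma leaf_conditions_iff:
  fixes V :: "plane_tree multiset"
  defines "L \<equiv> {#v \<in># V. degree v = 0#}" and "N \<equiv> {#v \<in># V. degree v \<noteq> 0#}"
  shows "size V = p + k \<and> size L = p \<and> (\<forall>v\<in>#L. label v = None) \<and>
      image_mset label N = mset_set (Some ` {1..k}) \<longleftrightarrow>
    (\<forall>v\<in>#V. degree v = 0 \<longleftrightarrow> label v = None \<or> label v = Some 0) \<and>
      image_mset label V = replicate_mset p None + mset_set (Some ` {1..k})"
    (is "?lhs \<longleftrightarrow> ?rhs")
proof
  have V: "V = L + N" unfolding L_def N_def by (rule multiset_partition)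
  {
    assume lhs: ?lhs
    have "image_mset label L = image_mset (\<lambda>_. None) L"
      using lhs by (intro image_mset_cong) auto
    then have "image_mset label L = replicate_mset p None"
      using lhs by (simp add: image_mset_const_eq)
    then have "image_mset label V = replicate_mset p None + mset_set (Some ` {1..k})"
      using lhs unfolding V by simp
    moreover have "degree v = 0 \<longleftrightarrow> label v = None \<or> label v = Some 0" if "v \<in># V" for v
    proof (cases "degree v = 0")
      case True
      with that lhs show ?thesis by (simp add: L_def)
    next
      case False
      with that have "label v \<in># image_mset label N" by (simp add: N_def)
      then have "label v \<in> Some ` {1..k}" using lhs by simp
      with False show ?thesis by auto
    qed
    ultimately show ?rhs by blast
  }
  assume rhs: ?rhs
  have "label v \<noteq> Some 0" if "v \<in># V" for v
  proof
    assume "label v = Some 0"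
    with that have "Some 0 \<in># image_mset label V" by (metis image_eqI set_image_mset)
    with rhs show False by (auto split: if_splits)
  qed
  with rhs have leaf: "degree v = 0 \<longleftrightarrow> label v = None" if "v \<in># V" for v
    using that by auto
  \<comment> \<open>The leaves are recovered from the labels alone, by filtering for
    \<open>None\<close>.\<close>
  have "image_mset label L = filter_mset (\<lambda>l. l = None) (image_mset label V)"
    unfolding L_def filter_mset_image_mset by (intro arg_cong[of _ _ "image_mset label"] filter_mset_cong)
      (auto simp: leaf)
  also have "\<dots> = replicate_mset p None"
    using rhs unfolding filter_eq_replicate_mset by (simp add: count_mset_set')
  finally have L: "image_mset label L = replicate_mset p None" .
  have "size V = size (image_mset label V)" by simp
  also have "\<dots> = p + k" using rhs by (simp add: card_image)
  finally have "size V = p + k" .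
  moreover have "size L = p" using L by (metis size_image_mset size_replicate_mset)
  moreover have "\<forall>v\<in>#L. label v = None" by (auto simp: L_def leaf)
  moreover have "image_mset label N = mset_set (Some ` {1..k})"
    using rhs L unfolding V by simp
  ultimately show ?lhs by blast
qed

lemma bij_betw_ordered_forests:
  assumes "1 \<le> r" "p \<le> n"
  defines "X \<equiv> replicate_mset p None + mset_set (Some ` {1..n - p})"
  shows "bij_betw mset {ts \<in> ordered_forests X r. Some m \<in># labels (hd ts)}
    (labeled_forests_below_1 n p r m)"
proof -
  define P where "P F \<longleftrightarrow> 
    (\<forall>v\<in>#forest_vertices F. degree v = 0 \<longleftrightarrow> label v = None \<or> label v = Some 0) \<and>
    image_mset label (forest_vertices F) = X \<and>
    (\<exists>t\<in>#F. label t = Some 1 \<and> (\<exists>v\<in>#vertices t. label v = Some m))" for F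
  have roots: "mset (map Some [1..<Suc r]) = mset_set (Some ` {1..r})"
    by (simp only: mset_map mset_upt image_mset_mset_set[OF inj_Some] 
        atLeastLessThanSuc_atLeastAtMost)
  have size: "size F = r" if "image_mset label F = mset_set (Some ` {1..r})" for F
    using that by (metis card_atLeastAtMost card_image diff_Suc_1 inj_Some size_image_mset size_mset_set)
  have "{F. image_mset label F = mset (map Some [1..<Suc r]) \<and> P F} =
      labeled_forests_below_1 n p r m"
    unfolding roots labeled_forests_below_1_def labeled_forests_def P_def
    using leaf_conditions_iff[where p = p and k = "n - p"] size \<open>p \<le> n\<close>
    by (auto simp: leaves_def non_leaves_def X_def)
  moreover have "{ts. map label ts = map Some [1..<Suc r] \<and> P (mset ts)} =
      {ts \<in> ordered_forests X r. Some m \<in># labels (hd ts)}"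
  proof -
    have "(\<exists>t\<in>#mset ts. label t = Some 1 \<and> (\<exists>v\<in>#vertices t. label v = Some m)) \<longleftrightarrow>
      Some m \<in># labels (hd ts)" if "map label ts = map Some [1..<Suc r]" for ts
    proof -
      have "length ts = r" using that by (metis diff_Suc_1 length_map length_upt)
      then obtain a us where ts: "ts = a # us" using \<open>1 \<le> r\<close> by (cases ts) auto
      with that \<open>1 \<le> r\<close> have "label a = Some 1" "map label us = map Some [Suc 1..<Suc r]"
        by (auto simp: upt_conv_Cons simp del: upt_Suc)
      \<comment> \<open>The remaining roots have labels from \<open>2\<close> on, so the tree with
        root \<open>1\<close> can only be the head.\<close>
      moreover from this(2) have "label t \<noteq> Some 1" if "t \<in> set us" for t
      proof -
        have "label t \<in> set (map label us)" using that by simp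
        then show ?thesis unfolding \<open>map label us = _\<close> by auto
      qed
      ultimately show ?thesis unfolding ts by (auto simp: labels_def image_iff) (metis)
    qed
    then show ?thesis
      unfolding ordered_forests_def P_def proper_forest_iff forest_labels_eq by blast
  qed
  moreover have "distinct (map Some [1..<Suc r])" by (simp add: distinct_map)
  ultimately show ?thesis using bij_betw_mset_sorted[of "map Some [1..<Suc r]" label P] by simp
qed


section \<open>Relabeling and marking\<close>

primrec relabel :: "(nat option \<Rightarrow> nat option) \<Rightarrow> plane_tree \<Rightarrow> plane_tree" where
  "relabel f (Node l ts) = Node (f l) (map (relabel f) ts)"

lemma label_relabel [simp]: "label (relabel f t) = f (label t)"
  by (cases t) auto

lemma labels_relabel [simp]: "labels (relabel f t) = image_mset f (labels t)"
proof (induction t)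
  case (Node l ts)
  then have "forest_labels (map (relabel f) ts) = image_mset f (forest_labels ts)"
    by (induction ts) auto
  then show ?case by simp
qed

lemma forest_labels_relabel [simp]:
  "forest_labels (map (relabel f) ts) = image_mset f (forest_labels ts)"
  by (induction ts) auto

lemma relabel_relabel: "relabel f (relabel g t) = relabel (f \<circ> g) t"
  by (induction t) auto

lemma relabel_id [simp]: "relabel id t = t"
  by (induction t) (auto intro: map_idI)

text \<open>Relabeling keeps the shape, so only the class of leaf labels \<open>None\<close> and
  \<open>Some 0\<close> has to be respected.\<close>

lemma proper_relabel:
  assumes "\<And>l. f l = None \<or> f l = Some 0 \<longleftrightarrow> l = None \<or> l = Some 0"
  shows "proper (relabel f t) \<longleftrightarrow> proper t"
  by (induction t) (auto simp: assms)

section \<open>Counting the ways to mark one leaf\<close>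

abbreviation unmark :: "nat option \<Rightarrow> nat option" where
  "unmark l \<equiv> (if l = Some 0 then None else l)"

lemma relabel_unmark_unmarked: "Some 0 \<notin># labels t \<Longrightarrow> relabel unmark t = t"
  by (induction t) (auto simp: in_forest_labels intro!: map_idI)

lemma unmarked_fibre:
  assumes "Some 0 \<notin># labels t"
  shows "{u. relabel unmark u = t \<and> Some 0 \<notin># labels u} = {t}"
  using assms relabel_unmark_unmarked by auto

lemma unmarked_forest_fibre:
  assumes "Some 0 \<notin># forest_labels ts"
  shows "{us. map (relabel unmark) us = ts \<and> Some 0 \<notin># forest_labels us} = {ts}"
proof -
  have "map (relabel unmark) us = us" if "Some 0 \<notin># forest_labels us" for us
    using that relabel_unmark_unmarked by (auto simp: in_forest_labels intro: map_idI)
  with assms show ?thesis by auto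
qed

text \<open>The only mark lies either in the first tree or in the rest, and the part without it is
  determined, so the counts add up. The tree case is an assumption because it is supplied by the
  induction hypothesis of \<open>card_marked_fibre\<close>.\<close>

lemma card_marked_forest_fibre_aux:
  assumes "\<And>t. t \<in> set ts \<Longrightarrow>
      finite {u. relabel unmark u = t \<and> count (labels u) (Some 0) = 1} \<and>
      card {u. relabel unmark u = t \<and> count (labels u) (Some 0) = 1} = count (labels t) None"
    and "Some 0 \<notin># forest_labels ts"
  shows "finite {us. map (relabel unmark) us = ts \<and> count (forest_labels us) (Some 0) = 1} \<and>
    card {us. map (relabel unmark) us = ts \<and> count (forest_labels us) (Some 0) = 1} =
      count (forest_labels ts) None"
  using assms
proof (induction ts)
  case Nil
  have "{us. map (relabel unmark) us = [] \<and> count (forest_labels us) (Some 0) = 1} = {}" by auto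
  then show ?case by simp
next
  case (Cons t ts)
  define T where "T = {u. relabel unmark u = t \<and> count (labels u) (Some 0) = 1}"
  define U where "U = {us. map (relabel unmark) us = ts \<and> count (forest_labels us) (Some 0) = 1}"
  have T: "finite T" "card T = count (labels t) None" using Cons.prems(1) by (auto simp: T_def)
  have U: "finite U" "card U = count (forest_labels ts) None"
    using Cons by (auto simp: U_def)
  have t: "relabel unmark u = t \<and> count (labels u) (Some 0) = 0 \<longleftrightarrow> u = t" for u
    using unmarked_fibre[of t] Cons.prems(2) by (auto simp: set_eq_iff count_eq_zero_iff)
  have ts: "map (relabel unmark) us = ts \<and> count (forest_labels us) (Some 0) = 0 \<longleftrightarrow> us = ts" for us
    using unmarked_forest_fibre[of ts] Cons.prems(2) by (auto simp: set_eq_iff count_eq_zero_iff)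
  have "{us. map (relabel unmark) us = t # ts \<and> count (forest_labels us) (Some 0) = 1} =
    (\<lambda>u. u # ts) ` T \<union> (\<lambda>us. t # us) ` U" (is "?W = _")
  proof (intro set_eqI)
    fix vs
    show "vs \<in> ?W \<longleftrightarrow> vs \<in> (\<lambda>u. u # ts) ` T \<union> (\<lambda>us. t # us) ` U"
    proof (cases vs)
      case (Cons v ws)
      have "vs \<in> ?W \<longleftrightarrow> v \<in> T \<and> ws = ts \<or> v = t \<and> ws \<in> U"
        using ts[of ws] t[of v] unfolding Cons T_def U_def mem_Collect_eq by (auto simp: add_is_1)
      then show ?thesis unfolding Cons by auto
    qed auto
  qed
  moreover have "(\<lambda>u. u # ts) ` T \<inter> (\<lambda>us. t # us) ` U = {}"
    using Cons.prems(2) by (auto simp: T_def count_eq_zero_iff)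
      (metis One_nat_def not_in_iff zero_neq_one)
  ultimately show ?case
    using T U by (simp add: card_Un_disjoint card_image inj_on_def)
qed

text \<open>A preimage arises by turning exactly one \<open>None\<close> of \<open>t\<close> into
  \<open>Some 0\<close>, either at the root or within the children.\<close>

lemma card_marked_fibre:
  assumes "Some 0 \<notin># labels t"
  shows "finite {u. relabel unmark u = t \<and> count (labels u) (Some 0) = 1} \<and>
    card {u. relabel unmark u = t \<and> count (labels u) (Some 0) = 1} = count (labels t) None"
  using assms
proof (induction t)
  case (Node l ts)
  define U where "U = {us. map (relabel unmark) us = ts \<and> count (forest_labels us) (Some 0) = 1}"
  have "finite U \<and> card U = count (forest_labels ts) None"
    unfolding U_def using Node
    by (intro card_marked_forest_fibre_aux) (auto simp: in_forest_labels)
  then have U: "finite U" "card U = count (forest_labels ts) None" by auto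
  have ts: "map (relabel unmark) us = ts \<and> count (forest_labels us) (Some 0) = 0 \<longleftrightarrow> us = ts" for us
    using unmarked_forest_fibre[of ts] Node.prems by (auto simp: set_eq_iff count_eq_zero_iff)
  have "{u. relabel unmark u = Node l ts \<and> count (labels u) (Some 0) = 1} =
    Node l ` U \<union> (if l = None then {Node (Some 0) ts} else {})" (is "?W = _")
  proof (intro set_eqI)
    fix u
    obtain l' us where u: "u = Node l' us" by (cases u)
    have "u \<in> ?W \<longleftrightarrow> l' = l \<and> us \<in> U \<or> l = None \<and> l' = Some 0 \<and> us = ts"
      using ts[of us] Node.prems unfolding u U_def mem_Collect_eq by auto
    then show "u \<in> ?W \<longleftrightarrow> u \<in> Node l ` U \<union> (if l = None then {Node (Some 0) ts} else {})"
      unfolding u by auto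
  qed
  then show ?case using U Node.prems by (auto simp: card_image inj_on_def card_insert_if)
qed

lemma card_marked_forest_fibre:
  assumes "Some 0 \<notin># forest_labels ts"
  shows "card {us. map (relabel unmark) us = ts \<and> count (forest_labels us) (Some 0) = 1} =
      count (forest_labels ts) None"
  using card_marked_forest_fibre_aux[of ts] card_marked_fibre assms by (auto simp: in_forest_labels)

text \<open>Double counting along the fibres. If \<open>A\<close> is infinite, then
  \<open>c > 0\<close> makes \<open>f\<close> hit all of \<open>A\<close>, so \<open>B\<close> is
  infinite and both sides are \<open>0\<close>; hence the forest sets need no finiteness
  proof.\<close>

lemma card_eq_mult_card_fibre:
  assumes "f ` B \<subseteq> A" "\<And>a. a \<in> A \<Longrightarrow> card {b \<in> B. f b = a} = c" "c > 0"
  shows "card B = c * card A"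
proof (cases "finite A")
  case True
  have fin: "finite {b \<in> B. f b = a}" if "a \<in> A" for a
    using assms(2)[OF that] \<open>c > 0\<close> by (metis (lifting) card.infinite less_numeral_extra(3))
  have "B = (\<Union>a\<in>A. {b \<in> B. f b = a})" using assms(1) by auto
  then have "card B = card (\<Union>a\<in>A. {b \<in> B. f b = a})" by simp
  also have "\<dots> = (\<Sum>a\<in>A. card {b \<in> B. f b = a})"
    using True fin by (intro card_UN_disjoint) auto
  finally show ?thesis using assms(2) by simp
next
  case False
  have "a \<in> f ` B" if "a \<in> A" for a
    using assms(2)[OF that] \<open>c > 0\<close> by (auto simp: card_gt_0_iff)
  then have "infinite B" using False finite_surj[of B A f] by blast
  with False show ?thesis by simp
qed

text \<open>Forgetting the mark is a map whose fibre over a forest has one element for each leaf;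
  \<open>Suc\<close> accounts for the leaf that \<open>add_mset None X\<close> has beyond
  \<open>X\<close>.\<close>

lemma card_marked_ordered_forests:
  fixes X :: "nat option multiset"
  assumes "Some 0 \<notin># X" "1 \<le> r" "k \<noteq> 0"
  shows "card {us \<in> ordered_forests (add_mset (Some 0) X) r. Some k \<in># labels (hd us)} =
    Suc (count X None) *
      card {ts \<in> ordered_forests (add_mset None X) r. Some k \<in># labels (hd ts)}"
proof (rule card_eq_mult_card_fibre)
  have X: "image_mset unmark X = X"
    using assms(1) by (intro multiset.map_ident_strong) auto
  have proper_iff: "proper (relabel unmark t) \<longleftrightarrow> proper t" for t by (rule proper_relabel) auto
  have mem: "Some k \<in># labels (hd (map (relabel unmark) us)) \<longleftrightarrow> Some k \<in># labels (hd us)"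
    if "length us = r" for us
  proof -
    have "us \<noteq> []" using that \<open>1 \<le> r\<close> by auto
    then show ?thesis using \<open>k \<noteq> 0\<close> by (auto simp: hd_map image_iff split: if_splits)
  qed
  have len: "length us = r" if "map label us = map Some [1..<Suc r]" for us :: "plane_tree list"
    using that by (metis diff_Suc_1 length_map length_upt)
  have roots: "map label (map (relabel unmark) us) = map Some [1..<Suc r]"
    if "map label us = map Some [1..<Suc r]" for us
  proof -
    have "map label (map (relabel unmark) us) = map unmark (map label us)" by simp
    also have "\<dots> = map Some [1..<Suc r]" unfolding that by (auto simp del: upt_Suc)
    finally show ?thesis .
  qed
  show "map (relabel unmark) ` {us \<in> ordered_forests (add_mset (Some 0) X) r. Some k \<in># labels (hd us)}
    \<subseteq> {ts \<in> ordered_forests (add_mset None X) r. Some k \<in># labels (hd ts)}"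
    using X mem len roots proper_iff by (auto simp: ordered_forests_def simp del: upt_Suc map_map)
  fix ts assume ts: "ts \<in> {ts \<in> ordered_forests (add_mset None X) r. Some k \<in># labels (hd ts)}"
  \<comment> \<open>A preimage of \<open>ts\<close> with exactly one mark is automatically a forest
    of the right kind, so this fibre is the one counted before.\<close>
  have "{us \<in> {us \<in> ordered_forests (add_mset (Some 0) X) r. Some k \<in># labels (hd us)}.
      map (relabel unmark) us = ts} =
    {us. map (relabel unmark) us = ts \<and> count (forest_labels us) (Some 0) = 1}" (is "?l = ?r")
  proof (intro set_eqI iffI)
    fix us assume "us \<in> ?l"
    then show "us \<in> ?r" using assms by (auto simp: ordered_forests_def not_in_iff)
  next
    fix us assume us: "us \<in> ?r"
    then have eq: "map (relabel unmark) us = ts" and c: "count (forest_labels us) (Some 0) = 1"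
      by auto
    have tsl: "map label ts = map Some [1..<Suc r]" and tsp: "\<forall>t\<in>set ts. proper t"
      and tsX: "forest_labels ts = add_mset None X" and tsk: "Some k \<in># labels (hd ts)"
      using ts by (auto simp: ordered_forests_def)
    have "proper u" if "u \<in> set us" for u using that tsp eq proper_iff by auto
    moreover have "map label us = map Some [1..<Suc r]"
    proof (rule nth_equalityI)
      show l: "length (map label us) = length (map Some [1..<Suc r])"
        using len[OF tsl] eq \<open>1 \<le> r\<close> by auto
      fix i assume "i < length (map label us)"
      then have i: "i < length us" "i < length ts" "i < r" using eq len[OF tsl] by auto
      have "unmark (label (us ! i)) = label (ts ! i)" using i eq by auto
      \<comment> \<open>A root label that is positive after unmarking was the same before; the shift
        by one comes from numbering the roots from \<open>1\<close>.\<close>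
      also have "\<dots> = Some (Suc i)" using arg_cong[OF tsl, of "\<lambda>x. x ! i"] i by (simp del: upt_Suc)
      finally show "map label us ! i = map Some [1..<Suc r] ! i"
        using i by (auto split: if_splits simp del: upt_Suc)
    qed
    moreover have "forest_labels us = add_mset (Some 0) X"
    proof -
      obtain Y where Y: "forest_labels us = add_mset (Some 0) Y"
        using c by (metis One_nat_def in_countE count_greater_zero_iff zero_less_one insert_DiffM)
      \<comment> \<open>Without its only mark the label multiset is fixed by \<open>unmark\<close>,
        so comparison with the labels of \<open>ts\<close> gives \<open>Y = X\<close>.\<close>
      have "Some 0 \<notin># Y" using c Y by (simp add: not_in_iff)
      then have "image_mset unmark Y = Y" by (intro multiset.map_ident_strong) auto
      moreover have "add_mset None X = image_mset unmark (forest_labels us)"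
        using tsX eq by (metis forest_labels_relabel)
      ultimately show ?thesis using Y by simp
    qed
    ultimately show "us \<in> ?l" using eq tsk mem len by (auto simp: ordered_forests_def simp del: upt_Suc)
  qed
  then show "card {us \<in> {us \<in> ordered_forests (add_mset (Some 0) X) r. Some k \<in># labels (hd us)}.
      map (relabel unmark) us = ts} = Suc (count X None)"
    using card_marked_forest_fibre[of ts] ts assms(1) by (auto simp: ordered_forests_def)
qed simp


section \<open>Cutting and grafting\<close>

primrec prune :: "nat \<Rightarrow> plane_tree \<Rightarrow> plane_tree" where
  "prune r (Node l ts) = (if l = Some r then Node (Some 0) [] else Node l (map (prune r) ts))"

text \<open>Collects the topmost subtrees with root label \<open>r\<close>. A list makes the
  function total and lets results be concatenated over a forest; in the application it has one
  entry.\<close>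

primrec cut_off :: "nat \<Rightarrow> plane_tree \<Rightarrow> plane_tree list" where
  "cut_off r (Node l ts) = (if l = Some r then [Node l ts] else concat (map (cut_off r) ts))"

primrec graft :: "plane_tree \<Rightarrow> plane_tree \<Rightarrow> plane_tree" where
  "graft s (Node l ts) = (if l = Some 0 then s else Node l (map (graft s) ts))"

lemma replicate_mset_add:
  "replicate_mset (m + n) x = replicate_mset m x + replicate_mset n x"
  by (induction m) auto

text \<open>A cut moves the labels of a subtree to \<open>cut_off\<close> and puts one mark in its
  place. Writing the balance with sums avoids multiset subtraction.\<close>

lemma labels_prune:
  "labels (prune r t) + forest_labels (cut_off r t) =
    labels t + replicate_mset (length (cut_off r t)) (Some 0)"
proof (induction t)
  case (Node l ts)
  then have "forest_labels (map (prune r) ts) + forest_labels (concat (map (cut_off r) ts)) =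
    forest_labels ts + replicate_mset (length (concat (map (cut_off r) ts))) (Some 0)"
  proof (induction ts)
    case (Cons t ts)
    have "labels (prune r t) + forest_labels (cut_off r t) =
        labels t + replicate_mset (length (cut_off r t)) (Some 0)"
      and "forest_labels (map (prune r) ts) + forest_labels (concat (map (cut_off r) ts)) =
        forest_labels ts + replicate_mset (length (concat (map (cut_off r) ts))) (Some 0)"
      using Cons by auto
    from arg_cong2[of _ _ _ _ "(+)", OF this] show ?case
      by (simp add: replicate_mset_add ac_simps)
  qed simp
  then show ?case by auto
qed

lemma forest_labels_prune:
  "forest_labels (map (prune r) ts) + forest_labels (concat (map (cut_off r) ts)) =
    forest_labels ts + replicate_mset (length (concat (map (cut_off r) ts))) (Some 0)"
  \<comment> \<open>An auxiliary root labeled \<open>None\<close> is never cut at and turns the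
    forest into a single tree.\<close>
  using labels_prune[of r "Node None ts"] by simp

lemma label_cut_off: "s \<in> set (cut_off r t) \<Longrightarrow> label s = Some r"
  by (induction t) (auto split: if_splits)

lemma in_labels_cut_off: "s \<in> set (cut_off r t) \<Longrightarrow> l \<in># labels s \<Longrightarrow> l \<in># labels t"
  by (induction t) (auto simp: in_forest_labels split: if_splits)

lemma cut_off_Nil_iff: "cut_off r t = [] \<longleftrightarrow> Some r \<notin># labels t"
  by (induction t) (auto simp: in_forest_labels)

lemma proper_prune: "r \<noteq> 0 \<Longrightarrow> proper t \<Longrightarrow> proper (prune r t)"
  by (induction t) auto

lemma proper_cut_off: "proper t \<Longrightarrow> s \<in> set (cut_off r t) \<Longrightarrow> proper s"
  by (induction t) (auto split: if_splits)

lemma label_prune: "label t \<noteq> Some r \<Longrightarrow> label (prune r t) = label t"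
  by (cases t) auto

text \<open>Only an inequality, since occurrences of \<open>Some r\<close> below a cut are not
  collected.\<close>

lemma length_cut_off: "length (cut_off r t) \<le> count (labels t) (Some r)"
proof (induction t)
  case (Node l ts)
  then have "length (concat (map (cut_off r) ts)) \<le> count (forest_labels ts) (Some r)"
    by (induction ts) (auto intro!: add_mono)
  then show ?case by auto
qed

text \<open>With no marks in \<open>t\<close>, every mark of the pruned tree is a cut place, and
  \<open>s\<close> is what was cut there.\<close>

lemma graft_prune:
  "set (cut_off r t) \<subseteq> {s} \<Longrightarrow> Some 0 \<notin># labels t \<Longrightarrow> graft s (prune r t) = t"
  by (induction t) (auto simp: in_forest_labels UN_subset_iff split: if_splits intro!: map_idI)

text \<open>The grafted copies of \<open>s\<close> are the only places to cut, and properness makes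
  a marked vertex childless, which is the leaf that \<open>prune\<close> puts back.\<close>

lemma prune_graft:
  "label s = Some r \<Longrightarrow> Some r \<notin># labels t \<Longrightarrow> proper t \<Longrightarrow> prune r (graft s t) = t"
  by (induction t; cases s) (auto simp: in_forest_labels intro!: map_idI)

lemma cut_off_graft:
  "label s = Some r \<Longrightarrow> Some r \<notin># labels t \<Longrightarrow> proper t \<Longrightarrow>
    cut_off r (graft s t) = replicate (count (labels t) (Some 0)) s"
proof (induction t)
  case (Node l ts)
  then have "cut_off r (graft s t) = replicate (count (labels t) (Some 0)) s" if "t \<in> set ts" for t
    using that by (auto simp: in_forest_labels)
  then have "concat (map (cut_off r \<circ> graft s) ts) =
    replicate (count (forest_labels ts) (Some 0)) s"
    by (induction ts) (auto simp: replicate_add)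
  then show ?case using Node by (cases s) auto
qed

lemma proper_graft: "proper s \<Longrightarrow> proper t \<Longrightarrow> proper (graft s t)"
  by (induction t) auto

lemma label_graft: "label t \<noteq> Some 0 \<Longrightarrow> label (graft s t) = label t"
  by (cases t) auto

text \<open>The inverse grafts the last tree onto the mark in the other trees. Requiring the mark to
  lie outside the last tree prevents grafting that tree into itself.\<close>

lemma bij_betw_prune:
  fixes X :: "nat option multiset"
  assumes X: "Some 0 \<notin># X" "count X (Some r) = 1" and r: "2 \<le> r" and k: "k \<noteq> 0" "k \<noteq> r"
  shows "bij_betw (\<lambda>ts. map (prune r) ts @ concat (map (cut_off r) ts))
    {ts \<in> ordered_forests X (r - 1). Some k \<in># labels (hd ts)}
    {us \<in> ordered_forests (add_mset (Some 0) X) r. Some 0 \<notin># labels (last us) \<and>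
      (Some k \<in># labels (hd us) \<or>
       Some 0 \<in># labels (hd us) \<and> Some k \<in># labels (last us))}"
    (is "bij_betw ?f ?A ?B")
proof (rule bij_betw_byWitness)
  have roots: "map Some [1..<Suc r] = map Some [1..<r] @ [Some r]" using r by simp
  have A: "\<exists>s. concat (map (cut_off r) ts) = [s] \<and> map (graft s) (map (prune r) ts) = ts \<and> ?f ts \<in> ?B"
    if "ts \<in> ?A" for ts
  proof -
    from that have l: "map label ts = map Some [1..<r]" and p: "\<And>t. t \<in> set ts \<Longrightarrow> proper t"
      and f: "forest_labels ts = X" and kh: "Some k \<in># labels (hd ts)"
      using r by (auto simp: ordered_forests_def)
    \<comment> \<open>As \<open>Some r\<close> occurs exactly once in \<open>X\<close>, there is
      exactly one cut.\<close>
    have "length (concat (map (cut_off r) ts)) \<le> 1"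
      using length_cut_off[of r "Node None ts"] X f by simp
    moreover have "concat (map (cut_off r) ts) \<noteq> []"
      using cut_off_Nil_iff[of r "Node None ts"] X f by (auto simp: not_in_iff)
    ultimately obtain s where s: "concat (map (cut_off r) ts) = [s]"
      by (cases "concat (map (cut_off r) ts)") auto
    then have sub: "set (cut_off r t) \<subseteq> {s}" if "t \<in> set ts" for t
    proof -
      have "set (cut_off r t) \<subseteq> set (concat (map (cut_off r) ts))" using that by auto
      then show ?thesis unfolding s by simp
    qed
    have ls: "label s = Some r" using label_cut_off[of s r "Node None ts"] s by auto
    have "s \<in> set (concat (map (cut_off r) ts))" using s by simp
    then have ps: "proper s" using p proper_cut_off by auto
    have lc: "map label (map (prune r) ts) = map Some [1..<r]"
    proof -
      have "label t \<noteq> Some r" if "t \<in> set ts" for t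
      proof -
        have "label t \<in> set (map label ts)" using that by simp
        then show ?thesis unfolding l by auto
      qed
      then show ?thesis unfolding l[symmetric] by (auto simp: label_prune)
    qed
    have fs: "forest_labels (map (prune r) ts) + labels s = add_mset (Some 0) X"
      using forest_labels_prune[of r ts] s f by simp
    have s0: "Some 0 \<notin># labels s"
    proof -
      obtain t where t: "t \<in> set ts" "s \<in> set (cut_off r t)"
        using \<open>s \<in> set (concat (map (cut_off r) ts))\<close> by auto
      have "\<forall>t\<in>set ts. Some 0 \<notin># labels t"
        using X(1) unfolding f[symmetric] in_forest_labels by blast
      then show ?thesis using in_labels_cut_off[OF t(2)] t(1) by blast
    qed
    obtain a as where ts: "ts = a # as" using l r by (cases ts) auto
    have "Some k \<in># labels (prune r a) \<or> Some 0 \<in># labels (prune r a) \<and> Some k \<in># labels s"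
    proof -
      \<comment> \<open>Either the first tree is untouched, or its labels and the new mark are
        divided between the pruned tree and \<open>s\<close>; as \<open>s\<close> has no mark, the
        mark stays in the pruned tree.\<close>
      consider "cut_off r a = []" | "cut_off r a = [s]" using s ts by (cases "cut_off r a") auto
      then show ?thesis
      proof cases
        case 1
        with labels_prune[of r a] kh ts show ?thesis by simp
      next
        case 2
        with labels_prune[of r a] have e: "labels (prune r a) + labels s = add_mset (Some 0) (labels a)"
          by simp
        have "x \<in># labels (prune r a) \<or> x \<in># labels s \<longleftrightarrow> x = Some 0 \<or> x \<in># labels a" for x
          using arg_cong[OF e, of set_mset] by auto
        from this[of "Some k"] this[of "Some 0"] s0 kh ts show ?thesis by auto
      qed
    qed
    then have "?f ts \<in> ?B"
      unfolding ordered_forests_def using lc roots ls ps p proper_prune[of r] r fs s0 s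
      by (auto simp: ts add.assoc)
    moreover have "map (graft s) (map (prune r) ts) = ts"
      using sub f X graft_prune by (auto simp: in_forest_labels intro!: map_idI)
    ultimately show ?thesis using s by blast
  qed
  have B: "?f (map (graft (last us)) (butlast us)) = us \<and> map (graft (last us)) (butlast us) \<in> ?A"
    if "us \<in> ?B" for us
  proof -
    from that have l: "map label us = map Some [1..<r] @ [Some r]"
      and p: "\<And>t. t \<in> set us \<Longrightarrow> proper t"
      and f: "forest_labels us = add_mset (Some 0) X" and s0: "Some 0 \<notin># labels (last us)"
      and kh: "Some k \<in># labels (hd us) \<or>
       Some 0 \<in># labels (hd us) \<and> Some k \<in># labels (last us)"
      using r unfolding ordered_forests_def roots by auto
    then obtain vs s where us: "us = vs @ [s]" by (cases us rule: rev_cases) auto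
    have lv: "map label vs = map Some [1..<r]" and ls: "label s = Some r" using l us by auto
    have ps: "proper s" and pv: "\<And>t. t \<in> set vs \<Longrightarrow> proper t" using p us by auto
    have fv: "forest_labels vs + labels s = add_mset (Some 0) X" using f us by simp
    have c: "count (forest_labels vs) x + count (labels s) x = (if x = Some 0 then 1 else 0) + count X x" for x
      using arg_cong[OF fv, of "\<lambda>M. count M x"] by auto
    have v0: "count (forest_labels vs) (Some 0) = 1"
      using c[of "Some 0"] X s0 us by (simp add: not_in_iff)
    \<comment> \<open>The root of \<open>s\<close> already uses up the single occurrence of
      \<open>Some r\<close>.\<close>
    have vr: "Some r \<notin># forest_labels vs"
    proof -
      have "Some r \<in># labels s" using ls label_in_labels[of s] by simp
      then have "count (labels s) (Some r) \<noteq> 0" by (simp add: count_eq_zero_iff)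
      moreover have "count (forest_labels vs) (Some r) + count (labels s) (Some r) = 1"
        using c[of "Some r"] X r by simp
      ultimately show ?thesis unfolding not_in_iff by linarith
    qed
    have cg: "map (prune r) (map (graft s) vs) = vs"
      using vr pv prune_graft[OF ls] by (auto simp: in_forest_labels intro!: map_idI)
    have coff: "cut_off r (graft s v) = replicate (count (labels v) (Some 0)) s" if "v \<in> set vs" for v
      using that vr pv cut_off_graft[OF ls] by (auto simp: in_forest_labels)
    have cog: "concat (map (cut_off r) (map (graft s) vs)) = [s]"
    proof -
      have "concat (map (cut_off r) (map (graft s) vs)) =
          replicate (count (forest_labels vs) (Some 0)) s"
        using coff by (induction vs) (auto simp: replicate_add)
      then show ?thesis using v0 by simp
    qed
    \<comment> \<open>Pruning the grafted forest gives back \<open>vs\<close> and \<open>s\<close>,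
      so the label balance of pruning cancels the mark in \<open>fv\<close>.\<close>
    have fg: "forest_labels (map (graft s) vs) = X"
      using forest_labels_prune[of r "map (graft s) vs"] cog cg fv by simp
    have lg: "map label (map (graft s) vs) = map Some [1..<r]"
    proof -
      have "label t \<noteq> Some 0" if "t \<in> set vs" for t
      proof -
        have "label t \<in> set (map label vs)" using that by simp
        then show ?thesis unfolding lv by auto
      qed
      then show ?thesis unfolding lv[symmetric] by (auto simp: label_graft)
    qed
    obtain a as where vs: "vs = a # as" using lv r by (cases vs) auto
    have "Some k \<in># labels (graft s a)"
    proof -
      \<comment> \<open>The label balance for the first tree alone, covering both the case where it
        carries the mark and the case where it does not.\<close>
      have e: "labels a + forest_labels (replicate (count (labels a) (Some 0)) s) =
        labels (graft s a) + replicate_mset (count (labels a) (Some 0)) (Some 0)"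
        using labels_prune[of r "graft s a"] coff[of a] cg vs by simp
      have "Some k \<in># labels a \<or> Some 0 \<in># labels a \<and> Some k \<in># labels s"
        using kh us vs by simp
      then have "Some k \<in># labels a + forest_labels (replicate (count (labels a) (Some 0)) s)"
        by (auto simp: in_forest_labels)
      then show ?thesis unfolding e using k by (auto split: if_splits)
    qed
    then have "map (graft s) vs \<in> ?A"
      using lg fg pv ps r by (auto simp: ordered_forests_def proper_graft vs)
    then show ?thesis using us cg cog by simp
  qed
  show "\<forall>ts\<in>?A. map (graft (last (?f ts))) (butlast (?f ts)) = ts"
  proof
    fix ts assume "ts \<in> ?A"
    from A[OF this] show "map (graft (last (?f ts))) (butlast (?f ts)) = ts" by auto
  qed
  show "\<forall>us\<in>?B. ?f (map (graft (last us)) (butlast us)) = us" using B by blast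
  show "?f ` ?A \<subseteq> ?B" using A by blast
  show "(\<lambda>us. map (graft (last us)) (butlast us)) ` ?B \<subseteq> ?A" using B by blast
qed


section \<open>Exchanging the first and the last tree\<close>

text \<open>Exchanging the labels \<open>1\<close> and \<open>r\<close> disorders the roots;
  exchanging the positions of the two trees restores their increasing order.\<close>

definition swap_ends :: "nat \<Rightarrow> plane_tree list \<Rightarrow> plane_tree list" where
  "swap_ends r us = map (relabel (map_option (transpose 1 r))) (last us # butlast (tl us) @ [hd us])"

lemma swap_ends_eq:
  "swap_ends r (a # us @ [b]) = map (relabel (map_option (transpose 1 r))) (b # us @ [a])"
  by (simp add: swap_ends_def)

lemma list_ends: "2 \<le> length us \<Longrightarrow> \<exists>a vs b. us = a # vs @ [b]"
  by (metis One_nat_def Suc_1 Suc_le_length_iff append_butlast_last_id list.distinct(1))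

lemma bij_betw_swap_ends:
  fixes X :: "nat option multiset"
  assumes X: "count X (Some 1) = count X (Some r)" and r: "2 \<le> r" and k: "k \<noteq> 1" "k \<noteq> r"
  shows "bij_betw (swap_ends r)
    {us \<in> ordered_forests X r. Some 0 \<in># labels (hd us) \<and> Some k \<in># labels (last us)}
    {us \<in> ordered_forests X r. Some 0 \<in># labels (last us) \<and> Some k \<in># labels (hd us)}"
    (is "bij_betw _ ?A ?B")
proof -
  define \<sigma> where "\<sigma> = map_option (transpose 1 r)"
  have \<sigma>\<sigma>: "\<sigma> \<circ> \<sigma> = id" "\<sigma> (\<sigma> l) = l" for l
    by (auto simp: \<sigma>_def fun_eq_iff option.map_comp o_def option.map_ident)
  have inj: "inj \<sigma>" by (metis \<sigma>\<sigma>(2) injI)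
  have fixed: "\<sigma> (Some 0) = Some 0" "\<sigma> (Some k) = Some k" using r k by (auto simp: \<sigma>_def)
  \<comment> \<open>The two exchanged labels have equal multiplicity in \<open>X\<close>, and all
    others are fixed.\<close>
  have X': "image_mset \<sigma> X = X"
  proof (rule multiset_eqI)
    fix l
    have "count (image_mset \<sigma> X) l = count (image_mset \<sigma> X) (\<sigma> (\<sigma> l))" using \<sigma>\<sigma> by simp
    also have "\<dots> = count X (\<sigma> l)" using inj by (induction X) (auto simp: inj_eq)
    also have "\<dots> = count X l" using X by (cases l) (auto simp: \<sigma>_def transpose_def)
    finally show "count (image_mset \<sigma> X) l = count X l" .
  qed
  have mem: "l \<in># labels (relabel \<sigma> t) \<longleftrightarrow> \<sigma> l \<in># labels t" for l t
    using \<sigma>\<sigma> by (metis (no_types, lifting) image_iff labels_relabel set_image_mset)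
  have proper_iff: "proper (relabel \<sigma> t) \<longleftrightarrow> proper t" for t
  proof (rule proper_relabel)
    fix l show "\<sigma> l = None \<or> \<sigma> l = Some 0 \<longleftrightarrow> l = None \<or> l = Some 0"
      using \<sigma>\<sigma>(2) fixed(1) by (metis \<sigma>_def option.map_disc_iff)
  qed
  have roots: "map Some [1..<Suc r] = Some 1 # map Some [2..<r] @ [Some r]"
    using r upt_conv_Cons[of 1 r] by (simp add: numeral_2_eq_2)
  have ends: "\<exists>a vs b. us = a # vs @ [b]" if "us \<in> ordered_forests X r" for us
    using r by (intro list_ends) (simp add: ordered_forests_length[OF that])
  have closed: "swap_ends r us \<in> ordered_forests X r" if us: "us \<in> ordered_forests X r" for us
  proof -
    obtain a vs b where u: "us = a # vs @ [b]" using ends[OF us] by blast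
    have l: "label a = Some 1" "map label vs = map Some [2..<r]" "label b = Some r"
      and f: "labels a + (forest_labels vs + labels b) = X"
      and p: "\<And>t. t \<in> set us \<Longrightarrow> proper t"
      using us unfolding ordered_forests_def roots u by auto
    have "map label (map (relabel \<sigma>) vs) = map \<sigma> (map Some [2..<r])"
      unfolding l(2)[symmetric] by simp
    also have "\<dots> = map Some [2..<r]" by (auto simp: \<sigma>_def)
    finally have lv: "map label (map (relabel \<sigma>) vs) = map Some [2..<r]" .
    have "image_mset \<sigma> (labels b + (forest_labels vs + labels a)) = X"
      using f X' by (simp only: ac_simps)
    then show ?thesis
      unfolding u swap_ends_eq \<sigma>_def[symmetric] ordered_forests_def roots
      using l lv p proper_iff u by (auto simp: \<sigma>_def)
  qed
  have invol: "swap_ends r (swap_ends r us) = us" if us: "us \<in> ordered_forests X r" for us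
  proof -
    obtain a vs b where u: "us = a # vs @ [b]" using ends[OF us] by blast
    have "relabel \<sigma> (relabel \<sigma> t) = t" for t unfolding relabel_relabel \<sigma>\<sigma> by simp
    then show ?thesis
      unfolding u swap_ends_eq \<sigma>_def[symmetric] list.map map_append by (simp add: o_def)
  qed
  have swapped: "swap_ends r us \<in> ?B \<longleftrightarrow> us \<in> ?A" "swap_ends r us \<in> ?A \<longleftrightarrow> us \<in> ?B"
    if us: "us \<in> ordered_forests X r" for us
  proof -
    obtain a vs b where u: "us = a # vs @ [b]" using ends[OF us] by blast
    show "swap_ends r us \<in> ?B \<longleftrightarrow> us \<in> ?A" "swap_ends r us \<in> ?A \<longleftrightarrow> us \<in> ?B"
      using closed[OF us] us mem fixed unfolding u swap_ends_eq \<sigma>_def[symmetric] by auto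
  qed
  show ?thesis
  proof (rule bij_betw_byWitness)
    show "\<forall>us\<in>?A. swap_ends r (swap_ends r us) = us" using invol by blast
    show "\<forall>us\<in>?B. swap_ends r (swap_ends r us) = us" using invol by blast
    show "swap_ends r ` ?A \<subseteq> ?B" using swapped by blast
    show "swap_ends r ` ?B \<subseteq> ?A" using swapped by blast
  qed
qed

text \<open>Both sets share the part \<open>P\<close>, where the mark is outside the last tree and
  \<open>k\<close> is in the first; the remaining parts \<open>A\<close> and \<open>B\<close>
  correspond under \<open>swap_ends\<close>.\<close>

lemma card_swap_ends:
  fixes X :: "nat option multiset"
  assumes X: "count X (Some 1) = count X (Some r)" "count X (Some k) = 1" "count X (Some 0) = 1"
    and r: "2 \<le> r" and k: "k \<noteq> 1" "k \<noteq> r"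
  shows "card {us \<in> ordered_forests X r. Some 0 \<notin># labels (last us) \<and>
      (Some k \<in># labels (hd us) \<or>
       Some 0 \<in># labels (hd us) \<and> Some k \<in># labels (last us))} =
    card {us \<in> ordered_forests X r. Some k \<in># labels (hd us)}"
proof -
  define P where "P = {us \<in> ordered_forests X r. Some 0 \<notin># labels (last us) \<and> Some k \<in># labels (hd us)}"
  define A where "A = {us \<in> ordered_forests X r. Some 0 \<in># labels (hd us) \<and> Some k \<in># labels (last us)}"
  define B where "B = {us \<in> ordered_forests X r. Some 0 \<in># labels (last us) \<and> Some k \<in># labels (hd us)}"
  \<comment> \<open>On \<open>A\<close> the label \<open>k\<close> lies in the last tree, hence not
    in the first, so \<open>f\<close> really swaps there, while it is the identity on
    \<open>P\<close>.\<close>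
  define f where "f us = (if Some k \<in># labels (hd us) then us else swap_ends r us)" for us
  have once: "\<not> (l \<in># labels (hd us) \<and> l \<in># labels (last us))"
    if us: "us \<in> ordered_forests X r" and l: "count X l = 1" for us l
  proof -
    obtain a vs b where u: "us = a # vs @ [b]"
      using list_ends ordered_forests_length[OF us] r by blast
    have "count (labels a) l + count (labels b) l \<le> 1"
      using us l by (auto simp: ordered_forests_def u)
    moreover have "count M l > 0 \<longleftrightarrow> l \<in># M" for M by simp
    ultimately show ?thesis unfolding u by (auto simp flip: count_greater_zero_iff)
  qed
  have "bij_betw f P P" by (rule bij_betw_cong[THEN iffD1, OF _ bij_betw_id]) (simp add: P_def f_def)
  moreover have "bij_betw f A B"
  proof (rule bij_betw_cong[THEN iffD1])
    show "bij_betw (swap_ends r) A B"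
      unfolding A_def B_def using X r k by (intro bij_betw_swap_ends) auto
    show "swap_ends r us = f us" if "us \<in> A" for us
      using that once[of us "Some k"] X by (auto simp: A_def f_def)
  qed
  moreover have "P \<inter> B = {}" by (auto simp: P_def B_def)
  ultimately have "bij_betw f (P \<union> A) (P \<union> B)" by (rule bij_betw_combine)
  then have "card (P \<union> A) = card (P \<union> B)" by (rule bij_betw_same_card)
  moreover have "P \<union> A = {us \<in> ordered_forests X r. Some 0 \<notin># labels (last us) \<and>
      (Some k \<in># labels (hd us) \<or> Some 0 \<in># labels (hd us) \<and> Some k \<in># labels (last us))}"
    using once[of _ "Some 0"] X by (auto simp: P_def A_def)
  moreover have "P \<union> B = {us \<in> ordered_forests X r. Some k \<in># labels (hd us)}"
    by (auto simp: P_def B_def)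
  ultimately show ?thesis by simp
qed

theorem theorem4p3:
  fixes n p r :: nat
  assumes "2 \<le> r" and "r < n - p"
  shows "card (labeled_forests_below_1 n p (r - 1) (n - p)) =
         (p + 1) * card (labeled_forests_below_1 (n + 1) (p + 1) r (n - p))"
proof -
  define k where "k = n - p"
  define X where "X = replicate_mset p None + mset_set (Some ` {1..k})"
  have count: "count X (Some i) = (if 1 \<le> i \<and> i \<le> k then 1 else 0)" "count X None = p" for i
    by (auto simp: X_def count_mset_set')
  have X0: "Some 0 \<notin># X" by (simp add: not_in_iff count)
  have "card (labeled_forests_below_1 n p (r - 1) k) =
      card {ts \<in> ordered_forests X (r - 1). Some k \<in># labels (hd ts)}"
    unfolding X_def k_def using assms
    by (intro bij_betw_same_card[OF bij_betw_ordered_forests, symmetric]) auto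
  \<comment> \<open>By \<open>2 \<le> r\<close> and \<open>r < k\<close>, the labels
    \<open>1\<close>, \<open>r\<close> and \<open>k\<close> are distinct and each occurs once in
    \<open>X\<close>.\<close>
  also have "\<dots> = card {us \<in> ordered_forests (add_mset (Some 0) X) r. Some 0 \<notin># labels (last us) \<and>
      (Some k \<in># labels (hd us) \<or> Some 0 \<in># labels (hd us) \<and> Some k \<in># labels (last us))}"
    using assms X0 by (intro bij_betw_same_card[OF bij_betw_prune]) (auto simp: count k_def)
  also have "\<dots> = card {us \<in> ordered_forests (add_mset (Some 0) X) r. Some k \<in># labels (hd us)}"
    using assms by (intro card_swap_ends) (auto simp: count k_def)
  also have "\<dots> = (p + 1) * card {ts \<in> ordered_forests (add_mset None X) r. Some k \<in># labels (hd ts)}"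
    using card_marked_ordered_forests[OF X0, of r k] assms by (simp add: count k_def)
  \<comment> \<open>Adding a leaf raises both \<open>n\<close> and \<open>p\<close> by one, so the
    range of labels \<open>{1..k}\<close> stays the same.\<close>
  also have "card {ts \<in> ordered_forests (add_mset None X) r. Some k \<in># labels (hd ts)} =
      card (labeled_forests_below_1 (n + 1) (p + 1) r k)"
    using bij_betw_same_card[OF bij_betw_ordered_forests[of r "p + 1" "n + 1" k]] assms
    by (simp add: X_def k_def)
  finally show ?thesis unfolding k_def .
qed

end
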